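(* For $\lambda\in\{\infty,-\infty\}$, $\mathcal{M}_\lambda\cap\textit{O-RV}=\emptyset$.
   Context: $\mathbb{R}^+=(0,\infty)$; functions $U:\mathbb{R}^+\to\mathbb{R}^+$ are thus strictly positive. $\mathcal{M}_\infty$ is the class of measurable functions $U:\mathbb{R}^+\to\mathbb{R}^+$ such that for all $\rho\in\mathbb{R}$, $\lim_{x\to\infty}U(x)/x^{\rho}=0$. $\mathcal{M}_{-\infty}$ is the class of measurable functions $U:\mathbb{R}^+\to\mathbb{R}^+$ such that for all $\rho\in\mathbb{R}$, $\lim_{x\to\infty}U(x)/x^{\rho}=\infty$. $\textit{O-RV}$ (the class of $O$-regularly varying functions) is the class of measurable functions $U:\mathbb{R}^+\to\mathbb{R}^+$ such that for all $t\ge1$, $$0<\liminf_{x\to\infty}\frac{U(tx)}{U(x)}\le\limsup_{x\to\infty}\frac{U(tx)}{U(x)}<\infty.$$ *)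

theory Defs
  imports "HOL-Analysis.Analysis"
begin

text \<open>
  Functions from the positive half-line to itself are total functions on the reals of which
  only the restriction to \<open>{0<..}\<close> matters. Measurability is Lebesgue measurability, so
  Borel functions are included.
\<close>

definition pos_measurable :: "(real \<Rightarrow> real) set" where
  "pos_measurable =
     {U. U \<in> {0<..} \<rightarrow> {0<..} \<and> U \<in> borel_measurable (lebesgue_on {0<..})}"

definition M_infinity :: "(real \<Rightarrow> real) set" where
  "M_infinity = {U \<in> pos_measurable.
     \<forall>\<rho>::real. ((\<lambda>x. U x / x powr \<rho>) \<longlongrightarrow> 0) at_top}"

definition M_minus_infinity :: "(real \<Rightarrow> real) set" where
  "M_minus_infinity = {U \<in> pos_measurable.
     \<forall>\<rho>::real. filterlim (\<lambda>x. U x / x powr \<rho>) at_top at_top}"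

text \<open>The lower and upper limits are taken in the extended reals, where they always exist.\<close>

definition O_RV :: "(real \<Rightarrow> real) set" where
  "O_RV = {U \<in> pos_measurable. \<forall>t\<ge>1.
     0 < Liminf at_top (\<lambda>x. ereal (U (t * x) / U x)) \<and>
     Liminf at_top (\<lambda>x. ereal (U (t * x) / U x)) \<le> Limsup at_top (\<lambda>x. ereal (U (t * x) / U x)) \<and>
     Limsup at_top (\<lambda>x. ereal (U (t * x) / U x)) < \<infinity>}"

end

theory Submission
  imports Defs
begin

text \<open>
  A positive lower bound \<open>c\<close> on the ratio \<open>U (2 * x) / U x\<close> for large \<open>x\<close> says exactly that
  \<open>U x / x powr \<rho>\<close>, with \<open>2 powr \<rho> = c\<close>, does not decrease when \<open>x\<close> is doubled. Along the points
  \<open>2 ^ n * a\<close>, for a large enough \<open>a\<close>, this quotient therefore stays above its value at \<open>a\<close>, which is positive, so it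
  cannot tend to \<open>0\<close>: thus an \<open>O\<close>-regularly varying function decays at most polynomially on a
  geometric sequence, and this excludes rapid decay. An upper bound on the same ratio is a lower
  bound for the reciprocal function, and the reciprocal turns divergence to infinity into
  convergence to \<open>0\<close>, so rapid growth is excluded by the same argument.
\<close>

text \<open>
  The exponent \<open>log 2 c\<close> is the growth order of a function satisfying \<open>U (2 * x) = c * U x\<close>;
  dividing by this power makes the quotient monotone along every sequence of repeated
  doublings that starts far enough out.
\<close>
lemma doubling_bound_not_tendsto_0:
  fixes U :: "real \<Rightarrow> real"
  assumes pos: "\<And>x. x > 0 \<Longrightarrow> U x > 0"
    and "c > 0"
    and doubling: "\<forall>\<^sub>F x in at_top. c * U x \<le> U (2 * x)"
  shows "\<not> ((\<lambda>x. U x / x powr log 2 c) \<longlongrightarrow> 0) at_top"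
proof
  define V where "V = (\<lambda>x. U x / x powr log 2 c)"
  assume "((\<lambda>x. U x / x powr log 2 c) \<longlongrightarrow> 0) at_top"
  then have lim: "(V \<longlongrightarrow> 0) at_top"
    by (simp add: V_def)
  obtain b where b: "\<And>x. x \<ge> b \<Longrightarrow> c * U x \<le> U (2 * x)"
    using doubling by (auto simp: eventually_at_top_linorder)
  define a where "a = max b 1"
  have a: "a > 0" "a \<ge> b"
    by (auto simp: a_def)
  have V_double: "V x \<le> V (2 * x)" if "x \<ge> a" for x
  proof -
    have "(2 * x) powr log 2 c = c * x powr log 2 c"
      using that a \<open>c > 0\<close> by (simp add: powr_mult)
    moreover have "c * U x \<le> U (2 * x)"
      using b that a by simp
    ultimately show ?thesis
      using that a \<open>c > 0\<close> by (simp add: V_def field_simps)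
  qed
  have V_geometric: "V a \<le> V (2 ^ n * a)" for n
  proof (induction n)
    case (Suc n)
    have "2 ^ n * a \<ge> a"
      using a by simp
    from V_double[OF this] Suc show ?case
      by (simp add: mult.assoc)
  qed simp
  have "filterlim (\<lambda>n. 2 ^ n * a) at_top sequentially"
    by (rule filterlim_at_top_mult_tendsto_pos[OF tendsto_const \<open>a > 0\<close>])
       (simp add: filterlim_at_top_iff_inverse_0 o_def LIMSEQ_inverse_realpow_zero)
  with lim have "(\<lambda>n. V (2 ^ n * a)) \<longlonglongrightarrow> 0"
    by (rule filterlim_compose)
  then have "V a \<le> 0"
    by (rule LIMSEQ_le_const) (use V_geometric in blast)
  moreover have "V a > 0"
    using pos a by (simp add: V_def)
  ultimately show False
    by simp
qed

lemma O_RV_doubling_lower_bound: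
  assumes "U \<in> O_RV"
  obtains c where "c > 0" and "\<forall>\<^sub>F x in at_top. c * U x \<le> U (2 * x)"
proof -
  have pos: "U x > 0" if "x > 0" for x
    using assms that by (auto simp: O_RV_def pos_measurable_def)
  have "0 < Liminf at_top (\<lambda>x. ereal (U (2 * x) / U x))"
    using assms by (simp add: O_RV_def)
  then obtain c where c: "0 < ereal c" "ereal c < Liminf at_top (\<lambda>x. ereal (U (2 * x) / U x))"
    using ereal_dense2 by blast
  from less_LiminfD[OF c(2)] have "\<forall>\<^sub>F x in at_top. c < U (2 * x) / U x"
    by simp
  then have "\<forall>\<^sub>F x in at_top. c * U x \<le> U (2 * x)"
    using eventually_gt_at_top[of 0]
    by eventually_elim (use pos in \<open>auto simp: pos_less_divide_eq\<close>)
  with c(1) show ?thesis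
    by (intro that) auto
qed

lemma O_RV_doubling_upper_bound:
  assumes "U \<in> O_RV"
  obtains C where "C > 0" and "\<forall>\<^sub>F x in at_top. U (2 * x) \<le> C * U x"
proof -
  have pos: "U x > 0" if "x > 0" for x
    using assms that by (auto simp: O_RV_def pos_measurable_def)
  have "Limsup at_top (\<lambda>x. ereal (U (2 * x) / U x)) < \<infinity>"
    using assms by (simp add: O_RV_def)
  then obtain B where B: "Limsup at_top (\<lambda>x. ereal (U (2 * x) / U x)) < ereal B"
    using ereal_dense2 by blast
  define C where "C = max B 1"
  from Limsup_lessD[OF B] have "\<forall>\<^sub>F x in at_top. U (2 * x) / U x < B"
    by simp
  then have "\<forall>\<^sub>F x in at_top. U (2 * x) \<le> C * U x"
    using eventually_gt_at_top[of 0]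
  proof eventually_elim
    case (elim x)
    then have "U (2 * x) / U x \<le> C"
      by (simp add: C_def)
    then show ?case
      using pos elim by (simp add: pos_divide_le_eq)
  qed
  moreover have "C > 0"
    by (simp add: C_def)
  ultimately show ?thesis
    by (intro that)
qed

theorem proposition5:
  shows "M_infinity \<inter> O_RV = {} \<and> M_minus_infinity \<inter> O_RV = {}"
proof (intro conjI equals0I)
  fix U assume U: "U \<in> M_infinity \<inter> O_RV"
  then have pos: "U x > 0" if "x > 0" for x
    using that by (auto simp: O_RV_def pos_measurable_def)
  obtain c where "c > 0" "\<forall>\<^sub>F x in at_top. c * U x \<le> U (2 * x)"
    using O_RV_doubling_lower_bound U by blast
  from doubling_bound_not_tendsto_0[OF pos this] U show False
    by (simp add: M_infinity_def)
next
  fix U assume U: "U \<in> M_minus_infinity \<inter> O_RV"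
  then have pos: "U x > 0" if "x > 0" for x
    using that by (auto simp: O_RV_def pos_measurable_def)
  obtain C where C: "C > 0" "\<forall>\<^sub>F x in at_top. U (2 * x) \<le> C * U x"
    using O_RV_doubling_upper_bound U by blast
  have doubling: "\<forall>\<^sub>F x in at_top. inverse C * inverse (U x) \<le> inverse (U (2 * x))"
    using C(2) eventually_gt_at_top[of 0]
  proof eventually_elim
    case (elim x)
    then have "inverse (C * U x) \<le> inverse (U (2 * x))"
      using pos by (intro le_imp_inverse_le) auto
    then show ?case
      by simp
  qed
  have "\<not> ((\<lambda>x. inverse (U x) / x powr log 2 (inverse C)) \<longlongrightarrow> 0) at_top"
    by (rule doubling_bound_not_tendsto_0[OF _ _ doubling]) (use pos C in auto)
  moreover have "((\<lambda>x. inverse (U x / x powr - log 2 (inverse C))) \<longlongrightarrow> 0) at_top"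
    using U by (intro tendsto_inverse_0_at_top) (simp add: M_minus_infinity_def)
  ultimately show False
    by (simp add: powr_minus divide_simps)
qed

end
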